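(* For $m=1,\dots,M$ let $\Gamma_{1,m}\ge\Gamma_{2,m}$ and $1<W_{2,m}/W_{1,m}<\Gamma_{1,m}/\Gamma_{2,m}$, and put $$\Omega_m=\frac{W_{2,m}\Gamma_{2,m}-W_{1,m}\Gamma_{1,m}}{\Gamma_{1,m}\Gamma_{2,m}(W_{1,m}-W_{2,m})}.$$ Let $\Theta_m>2\Omega_m$ be positive numbers with $P\ge\sum_{m=1}^M\Theta_m$, and let $\alpha>0$ be given. Consider the problem $$\max_{\boldsymbol q}\ H(\boldsymbol q,\alpha)\quad\text{s.t.}\quad\sum_{m=1}^Mq_m\le P,\ \ q_m\ge\Theta_m\ \forall m,$$ where $\boldsymbol q=(q_1,\dots,q_M)$ and $$H(\boldsymbol q,\alpha)=\sum_{m=1}^M\left(W_{1,m}B_c\log(1+\Omega_m\Gamma_{1,m})+W_{2,m}B_c\log\left(\frac{q_m\Gamma_{2,m}+1}{\Omega_m\Gamma_{2,m}+1}\right)\right)-\alpha\left(P_T+\sum_{m=1}^Mq_m\right).$$ The optimal solution to this problem is $$q_m^\star=\left[\frac{W_{2,m}B_c}{\alpha+\lambda}-\frac1{\Gamma_{2,m}}\right]_{\Theta_m}^{\infty},\qquad m=1,\dots,M,$$ where $\lambda$ is chosen such that $\sum_{m=1}^Mq_m^\star=P$.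
   Context: Notation: $[x]_a^\infty=\max\{x,a\}$; $\log$ is the logarithm used in the definition of the data rates (its base is not specified in the source). Setting: downlink NOMA (non-orthogonal multiple access) system with $M$ channels of bandwidth $B_c>0$ and two users per channel; $\Gamma_{l,m}>0$ is the channel-to-noise ratio and $W_{l,m}>0$ the weight of user $l$ on channel $m$, $q_m$ is the power budget of channel $m$, $P$ the total power budget of the base station, $P_T$ the circuit power consumption, and $\alpha$ the parameter of the Dinkelbach-type parametrization of the weighted energy efficiency maximization problem.
   Formalization: As stated this fails when the power budget is slack at the optimum (large α); the formal version requires λ ≥ 0, shows such λ with Σq*=P exists iff Σq* at λ=0 is at least P, and otherwise takes λ=0; log is the natural logarithm. *)

theory Defs
  imports "HOL-Analysis.Analysis"
begin

text \<open>
  The M channels are the elements of a finite type, so M is \<open>CARD('m)\<close>. A per-channel quantity,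
  the decision variable q included, is a vector in \<open>real ^ 'm\<close>; the user index 1, 2 is a subscript.
\<close>

definition noma_Omega ::
  "real ^ 'm \<Rightarrow> real ^ 'm \<Rightarrow> real ^ 'm \<Rightarrow> real ^ 'm \<Rightarrow> 'm::finite \<Rightarrow> real" where
  "noma_Omega W\<^sub>1 W\<^sub>2 \<Gamma>\<^sub>1 \<Gamma>\<^sub>2 m =
     (W\<^sub>2 $ m * \<Gamma>\<^sub>2 $ m - W\<^sub>1 $ m * \<Gamma>\<^sub>1 $ m) / (\<Gamma>\<^sub>1 $ m * \<Gamma>\<^sub>2 $ m * (W\<^sub>1 $ m - W\<^sub>2 $ m))"

text \<open>
  Rates use the natural logarithm: with it, \<open>\<lambda>\<close> in the water level \<open>W\<^sub>2 B\<^sub>c / (\<alpha> + \<lambda>)\<close> below is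
  the Lagrange multiplier of the total power constraint (any other base would contribute a factor
  to \<open>\<alpha> + \<lambda>\<close>).
\<close>

definition noma_H ::
  "real ^ 'm \<Rightarrow> real ^ 'm \<Rightarrow> real ^ 'm \<Rightarrow> real ^ 'm \<Rightarrow> real \<Rightarrow> real \<Rightarrow> real ^ 'm \<Rightarrow> real \<Rightarrow> real" where
  "noma_H W\<^sub>1 W\<^sub>2 \<Gamma>\<^sub>1 \<Gamma>\<^sub>2 B\<^sub>c P\<^sub>T q \<alpha> =
     (\<Sum>m\<in>UNIV. W\<^sub>1 $ m * B\<^sub>c * ln (1 + noma_Omega W\<^sub>1 W\<^sub>2 \<Gamma>\<^sub>1 \<Gamma>\<^sub>2 m * \<Gamma>\<^sub>1 $ m)
        + W\<^sub>2 $ m * B\<^sub>c *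
          ln ((q $ m * \<Gamma>\<^sub>2 $ m + 1) / (noma_Omega W\<^sub>1 W\<^sub>2 \<Gamma>\<^sub>1 \<Gamma>\<^sub>2 m * \<Gamma>\<^sub>2 $ m + 1)))
     - \<alpha> * (P\<^sub>T + (\<Sum>m\<in>UNIV. q $ m))"

definition noma_feasible :: "real ^ 'm \<Rightarrow> real \<Rightarrow> real ^ 'm \<Rightarrow> bool" where
  "noma_feasible \<Theta> P q \<longleftrightarrow> (\<Sum>m\<in>UNIV. q $ m) \<le> P \<and> (\<forall>m. q $ m \<ge> \<Theta> $ m)"

definition noma_qstar ::
  "real ^ 'm \<Rightarrow> real ^ 'm \<Rightarrow> real \<Rightarrow> real ^ 'm \<Rightarrow> real \<Rightarrow> real \<Rightarrow> real ^ 'm" where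
  "noma_qstar W\<^sub>2 \<Gamma>\<^sub>2 B\<^sub>c \<Theta> \<alpha> lam =
     (\<chi> m. max (W\<^sub>2 $ m * B\<^sub>c / (\<alpha> + lam) - 1 / \<Gamma>\<^sub>2 $ m) (\<Theta> $ m))"

text \<open>\<open>q\<close> is the optimal solution, i.e. the unique maximiser over the feasible set.\<close>

definition noma_the_optimum ::
  "real ^ 'm \<Rightarrow> real ^ 'm \<Rightarrow> real ^ 'm \<Rightarrow> real ^ 'm \<Rightarrow> real \<Rightarrow> real \<Rightarrow> real ^ 'm \<Rightarrow> real \<Rightarrow> real \<Rightarrow>
   real ^ 'm \<Rightarrow> bool" where
  "noma_the_optimum W\<^sub>1 W\<^sub>2 \<Gamma>\<^sub>1 \<Gamma>\<^sub>2 B\<^sub>c P\<^sub>T \<Theta> P \<alpha> q \<longleftrightarrow>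
     (\<forall>q'. is_arg_max (\<lambda>x. noma_H W\<^sub>1 W\<^sub>2 \<Gamma>\<^sub>1 \<Gamma>\<^sub>2 B\<^sub>c P\<^sub>T x \<alpha>) (noma_feasible \<Theta> P) q' \<longleftrightarrow> q' = q)"

end

theory Submission
  imports Defs
begin

text \<open>
  For a multiplier \<open>lam \<ge> 0\<close> the Lagrangian
  \<open>H q \<alpha> - lam * (\<Sum>m\<in>UNIV. q $ m)\<close> separates over the channels, and
  in each channel the strict form of \<open>ln x \<le> x - 1\<close> shows that the truncated water level is
  the unique maximiser on \<open>{\<Theta>..}\<close>. Complementary slackness, \<open>lam = 0\<close> or total power
  equal to \<open>P\<close>, turns this into optimality. The total power is continuous and decreasing in
  \<open>lam\<close> and equals the sum of the \<open>\<Theta>\<close> for large \<open>lam\<close>, so the intermediate value theorem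
  decides when it attains \<open>P\<close>.
\<close>

lemma water_level_strict_max:
  fixes w g \<mu> t x :: real
  defines "q \<equiv> max (w / \<mu> - 1 / g) t"
  assumes "w > 0" "g > 0" "\<mu> > 0" "t > 0" "t \<le> x" "x \<noteq> q"
  shows "w * ln (x * g + 1) - \<mu> * x < w * ln (q * g + 1) - \<mu> * q"
proof -
  have q: "q > 0" "t \<le> q"
    using assms by (auto simp: q_def)
  have pos: "q * g + 1 > 0" "x * g + 1 > 0"
    using assms q by (auto intro!: add_pos_pos)
  \<comment> \<open>With this ratio, \<open>w * (r - 1)\<close> is the tangent of
    \<open>w * ln (_ * g + 1)\<close> at \<open>q\<close> evaluated at the increment
    \<open>x - q\<close>. The bound on \<open>ln r\<close> is thus strict concavity.\<close>
  define r where "r = (x * g + 1) / (q * g + 1)"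
  have r: "r > 0"
    using pos by (simp add: r_def)
  have "r \<noteq> 1"
    using pos assms by (auto simp: r_def divide_simps)
  then have "ln r < r - 1"
    using r ln_le_minus_one[of r] ln_eq_minus_one[of r] by fastforce
  moreover have "ln r = ln (x * g + 1) - ln (q * g + 1)"
    using pos by (simp add: r_def ln_div)
  moreover have "r - 1 = g * (x - q) / (q * g + 1)"
    using pos by (simp add: r_def field_simps)
  ultimately have "w * (ln (x * g + 1) - ln (q * g + 1)) < w * (g * (x - q) / (q * g + 1))"
    using \<open>w > 0\<close> by (intro mult_strict_left_mono) simp_all
  also have "\<dots> = w * g / (q * g + 1) * (x - q)"
    by simp
  \<comment> \<open>The tangent slope at \<open>q\<close> is exactly \<mu> at the untruncated water
    level. If the floor is active, the slope is at most \<mu>, and this suffices because then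
    \<open>x - q = x - t\<close> is nonnegative.\<close>
  also have "\<dots> \<le> \<mu> * (x - q)"
  proof (cases "q = t")
    case True
    then have "w / \<mu> - 1 / g \<le> q"
      by (auto simp: q_def max_def split: if_splits)
    then have "w * g / (q * g + 1) \<le> \<mu>"
      using assms(2-4) pos by (simp add: field_simps)
    then show ?thesis
      using True assms(6) by (intro mult_right_mono) auto
  next
    case False
    then have "q = w / \<mu> - 1 / g"
      by (auto simp: q_def max_def split: if_splits)
    then have "w * g / (q * g + 1) = \<mu>"
      using assms(2-4) pos by (simp add: field_simps)
    then show ?thesis by simp
  qed
  finally show ?thesis
    by (simp add: algebra_simps)
qed

text \<open>The upper bound on the weight ratio makes the numerator negative, the lower bound the
  denominator. Positivity allows the logarithm of the quotient in \<open>noma_H\<close> to be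
  split.\<close>

lemma noma_Omega_pos:
  assumes "W\<^sub>1 $ m > 0" "\<Gamma>\<^sub>1 $ m > 0" "\<Gamma>\<^sub>2 $ m > 0"
    and "1 < W\<^sub>2 $ m / W\<^sub>1 $ m" "W\<^sub>2 $ m / W\<^sub>1 $ m < \<Gamma>\<^sub>1 $ m / \<Gamma>\<^sub>2 $ m"
  shows "noma_Omega W\<^sub>1 W\<^sub>2 \<Gamma>\<^sub>1 \<Gamma>\<^sub>2 m > 0"
  unfolding noma_Omega_def using assms
  by (intro divide_neg_neg mult_pos_neg) (auto simp: field_simps)

text \<open>Everything independent of the power vector cancels, leaving separable terms.
  \<open>lam\<close> is an arbitrary real: its contribution to the channel terms is undone by the
  last summand.\<close>

lemma noma_H_diff:
  fixes x y :: "real ^ 'm::finite"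
  assumes "\<And>m. \<Gamma>\<^sub>2 $ m > 0" "\<And>m. noma_Omega W\<^sub>1 W\<^sub>2 \<Gamma>\<^sub>1 \<Gamma>\<^sub>2 m > 0"
    and "\<And>m. x $ m > 0" "\<And>m. y $ m > 0"
  shows "noma_H W\<^sub>1 W\<^sub>2 \<Gamma>\<^sub>1 \<Gamma>\<^sub>2 B\<^sub>c P\<^sub>T x \<alpha> - noma_H W\<^sub>1 W\<^sub>2 \<Gamma>\<^sub>1 \<Gamma>\<^sub>2 B\<^sub>c P\<^sub>T y \<alpha> =
    (\<Sum>m\<in>UNIV. W\<^sub>2 $ m * B\<^sub>c * ln (x $ m * \<Gamma>\<^sub>2 $ m + 1) - (\<alpha> + lam) * x $ m)
    - (\<Sum>m\<in>UNIV. W\<^sub>2 $ m * B\<^sub>c * ln (y $ m * \<Gamma>\<^sub>2 $ m + 1) - (\<alpha> + lam) * y $ m)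
    + lam * ((\<Sum>m\<in>UNIV. x $ m) - (\<Sum>m\<in>UNIV. y $ m))"
proof -
  have "ln ((z * \<Gamma>\<^sub>2 $ m + 1) / (noma_Omega W\<^sub>1 W\<^sub>2 \<Gamma>\<^sub>1 \<Gamma>\<^sub>2 m * \<Gamma>\<^sub>2 $ m + 1))
      = ln (z * \<Gamma>\<^sub>2 $ m + 1) - ln (noma_Omega W\<^sub>1 W\<^sub>2 \<Gamma>\<^sub>1 \<Gamma>\<^sub>2 m * \<Gamma>\<^sub>2 $ m + 1)" if "z > 0" for z m
    using that assms(1,2)[of m] by (simp add: ln_div add_pos_pos less_imp_neq[THEN not_sym])
  note split = this[OF assms(3)] this[OF assms(4)]
  show ?thesis
    unfolding noma_H_def split
    by (simp add: sum.distrib sum_subtractf sum_distrib_left[symmetric] algebra_simps)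
qed

text \<open>The disjunction lets one statement serve both an exhausted budget with any
  \<open>lam \<ge> 0\<close> and a slack budget with \<open>lam = 0\<close>.\<close>

lemma noma_qstar_optimal:
  fixes W\<^sub>1 W\<^sub>2 \<Gamma>\<^sub>1 \<Gamma>\<^sub>2 \<Theta> :: "real ^ 'm::finite"
  assumes "B\<^sub>c > 0" "\<And>m. W\<^sub>2 $ m > 0" "\<And>m. \<Gamma>\<^sub>2 $ m > 0" "\<And>m. \<Theta> $ m > 0" "\<alpha> > 0" "lam \<ge> 0"
    and "\<And>m. noma_Omega W\<^sub>1 W\<^sub>2 \<Gamma>\<^sub>1 \<Gamma>\<^sub>2 m > 0"
    and "(\<Sum>m\<in>UNIV. noma_qstar W\<^sub>2 \<Gamma>\<^sub>2 B\<^sub>c \<Theta> \<alpha> lam $ m) \<le> P"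
    and "lam = 0 \<or> (\<Sum>m\<in>UNIV. noma_qstar W\<^sub>2 \<Gamma>\<^sub>2 B\<^sub>c \<Theta> \<alpha> lam $ m) = P"
  shows "noma_the_optimum W\<^sub>1 W\<^sub>2 \<Gamma>\<^sub>1 \<Gamma>\<^sub>2 B\<^sub>c P\<^sub>T \<Theta> P \<alpha> (noma_qstar W\<^sub>2 \<Gamma>\<^sub>2 B\<^sub>c \<Theta> \<alpha> lam)"
proof -
  define q where "q = noma_qstar W\<^sub>2 \<Gamma>\<^sub>2 B\<^sub>c \<Theta> \<alpha> lam"
  define H where "H = (\<lambda>x. noma_H W\<^sub>1 W\<^sub>2 \<Gamma>\<^sub>1 \<Gamma>\<^sub>2 B\<^sub>c P\<^sub>T x \<alpha>)"
  define L where "L x m = W\<^sub>2 $ m * B\<^sub>c * ln (x $ m * \<Gamma>\<^sub>2 $ m + 1) - (\<alpha> + lam) * x $ m"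
    for x :: "real ^ 'm" and m
  have q_nth: "q $ m = max (W\<^sub>2 $ m * B\<^sub>c / (\<alpha> + lam) - 1 / \<Gamma>\<^sub>2 $ m) (\<Theta> $ m)" for m
    by (simp add: q_def noma_qstar_def)
  have feas: "noma_feasible \<Theta> P q"
    using assms(8) by (simp add: noma_feasible_def q_nth) (simp add: q_def noma_qstar_def)
  have feas_pos: "x $ m > 0" if "noma_feasible \<Theta> P x" for x m
    using that assms(4)[of m] unfolding noma_feasible_def by (meson less_le_trans)
  have better: "H x < H q" if x: "noma_feasible \<Theta> P x" and "x \<noteq> q" for x
  proof -
    have strict: "L x m < L q m" if "x $ m \<noteq> q $ m" for m
      unfolding L_def q_nth using x that assms(1-6)
      by (intro water_level_strict_max) (auto simp: noma_feasible_def q_nth)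
    have weak: "L x m \<le> L q m" for m
      using strict[of m] by (cases "x $ m = q $ m") (auto simp: L_def)
    obtain k where "x $ k \<noteq> q $ k"
      using \<open>x \<noteq> q\<close> by (auto simp: vec_eq_iff)
    then have "(\<Sum>m\<in>UNIV. L x m) < (\<Sum>m\<in>UNIV. L q m)"
      using weak strict by (intro sum_strict_mono_ex1) auto
    \<comment> \<open>Complementary slackness: either the factor \<open>lam\<close> vanishes, or
      \<open>q\<close> spends all of \<open>P\<close> and no feasible \<open>x\<close> spends
      more.\<close>
    moreover have "lam * ((\<Sum>m\<in>UNIV. x $ m) - (\<Sum>m\<in>UNIV. q $ m)) \<le> 0"
      using assms(6,9) x by (auto simp: noma_feasible_def q_def mult_le_0_iff)
    moreover have "H x - H q = (\<Sum>m\<in>UNIV. L x m) - (\<Sum>m\<in>UNIV. L q m)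
        + lam * ((\<Sum>m\<in>UNIV. x $ m) - (\<Sum>m\<in>UNIV. q $ m))"
      unfolding H_def L_def using assms feas_pos x feas by (intro noma_H_diff) auto
    ultimately show ?thesis by linarith
  qed
  then have "is_arg_max H (noma_feasible \<Theta> P) x \<longleftrightarrow> x = q" for x
    using feas unfolding is_arg_max_def by (metis less_asym)
  then show ?thesis
    by (simp add: noma_the_optimum_def H_def q_def)
qed

lemma noma_qstar_antimono:
  assumes "B\<^sub>c > 0" "W\<^sub>2 $ m > 0" "0 < \<alpha> + lam" "lam \<le> lam'"
  shows "noma_qstar W\<^sub>2 \<Gamma>\<^sub>2 B\<^sub>c \<Theta> \<alpha> lam' $ m \<le> noma_qstar W\<^sub>2 \<Gamma>\<^sub>2 B\<^sub>c \<Theta> \<alpha> lam $ m"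
  unfolding noma_qstar_def vec_lambda_beta using assms
  by (intro max.mono diff_mono order_refl divide_left_mono mult_pos_pos) auto

text \<open>Already the first term of the water level is below the floor, before
  \<open>1 / \<Gamma>\<^sub>2 $ m\<close> is subtracted. This supplies the right endpoint for the
  intermediate value argument.\<close>

lemma noma_qstar_eq_floor:
  assumes "\<Gamma>\<^sub>2 $ m > 0" "\<Theta> $ m > 0" "W\<^sub>2 $ m * B\<^sub>c / \<Theta> $ m \<le> \<alpha> + lam" "0 < \<alpha> + lam"
  shows "noma_qstar W\<^sub>2 \<Gamma>\<^sub>2 B\<^sub>c \<Theta> \<alpha> lam $ m = \<Theta> $ m"
proof -
  have "W\<^sub>2 $ m * B\<^sub>c / (\<alpha> + lam) \<le> \<Theta> $ m"
    using assms by (simp add: field_simps)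
  moreover have "1 / \<Gamma>\<^sub>2 $ m > 0"
    using assms by simp
  ultimately show ?thesis
    unfolding noma_qstar_def vec_lambda_beta by linarith
qed

lemma noma_multiplier_exists_iff:
  fixes W\<^sub>2 \<Gamma>\<^sub>2 \<Theta> :: "real ^ 'm::finite"
  assumes "B\<^sub>c > 0" "\<And>m. W\<^sub>2 $ m > 0" "\<And>m. \<Gamma>\<^sub>2 $ m > 0" "\<And>m. \<Theta> $ m > 0" "\<alpha> > 0"
    and "(\<Sum>m\<in>UNIV. \<Theta> $ m) \<le> P"
  shows "(\<exists>lam\<ge>0. (\<Sum>m\<in>UNIV. noma_qstar W\<^sub>2 \<Gamma>\<^sub>2 B\<^sub>c \<Theta> \<alpha> lam $ m) = P) \<longleftrightarrow>
    P \<le> (\<Sum>m\<in>UNIV. noma_qstar W\<^sub>2 \<Gamma>\<^sub>2 B\<^sub>c \<Theta> \<alpha> 0 $ m)"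
proof
  assume "\<exists>lam\<ge>0. (\<Sum>m\<in>UNIV. noma_qstar W\<^sub>2 \<Gamma>\<^sub>2 B\<^sub>c \<Theta> \<alpha> lam $ m) = P"
  then show "P \<le> (\<Sum>m\<in>UNIV. noma_qstar W\<^sub>2 \<Gamma>\<^sub>2 B\<^sub>c \<Theta> \<alpha> 0 $ m)"
    using assms by (auto intro!: sum_mono noma_qstar_antimono)
next
  define S where "S lam = (\<Sum>m\<in>UNIV. noma_qstar W\<^sub>2 \<Gamma>\<^sub>2 B\<^sub>c \<Theta> \<alpha> lam $ m)" for lam
  assume "P \<le> (\<Sum>m\<in>UNIV. noma_qstar W\<^sub>2 \<Gamma>\<^sub>2 B\<^sub>c \<Theta> \<alpha> 0 $ m)"
  then have upper: "P \<le> S 0"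
    by (simp add: S_def)
  \<comment> \<open>A single multiplier that pushes every channel to its floor: the sum of the
    nonnegative thresholds dominates each of them.\<close>
  define b where "b = (\<Sum>m\<in>UNIV. W\<^sub>2 $ m * B\<^sub>c / \<Theta> $ m)"
  have nonneg: "0 \<le> W\<^sub>2 $ m * B\<^sub>c / \<Theta> $ m" for m
    using assms(1) assms(2,4)[of m] by simp
  then have b: "b \<ge> 0"
    by (simp add: b_def sum_nonneg)
  have "W\<^sub>2 $ m * B\<^sub>c / \<Theta> $ m \<le> b" for m
    unfolding b_def using nonneg by (intro member_le_sum) auto
  then have "W\<^sub>2 $ m * B\<^sub>c / \<Theta> $ m \<le> \<alpha> + b" for m
    using \<open>\<alpha> > 0\<close> by (meson add_increasing less_imp_le)
  then have "noma_qstar W\<^sub>2 \<Gamma>\<^sub>2 B\<^sub>c \<Theta> \<alpha> b $ m = \<Theta> $ m" for m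
    using b assms by (intro noma_qstar_eq_floor) auto
  then have "S b \<le> P"
    using assms(6) by (simp add: S_def)
  \<comment> \<open>Since \<alpha> is positive, the denominator \<open>\<alpha> + lam\<close> has no
    zero on this interval.\<close>
  moreover have "continuous_on {0..b} S"
    unfolding S_def noma_qstar_def using \<open>\<alpha> > 0\<close>
    by (auto intro!: continuous_intros)
  ultimately obtain lam where "0 \<le> lam" "S lam = P"
    using IVT2'[of S b P 0] upper b by auto
  then show "\<exists>lam\<ge>0. (\<Sum>m\<in>UNIV. noma_qstar W\<^sub>2 \<Gamma>\<^sub>2 B\<^sub>c \<Theta> \<alpha> lam $ m) = P"
    by (auto simp: S_def)
qed

text \<open>Since \<alpha> already charges for power, the optimum may leave budget unspent. Then no
  \<open>lam \<ge> 0\<close> meets the budget with equality, and the multiplier is 0; the last two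
  conjuncts make this precise. The sign condition matters: a \<open>lam\<close> between
  \<open>-\<alpha>\<close> and 0 could exhaust the budget by spending more than is optimal.\<close>

theorem theorem4:
  fixes W\<^sub>1 W\<^sub>2 \<Gamma>\<^sub>1 \<Gamma>\<^sub>2 \<Theta> :: "real ^ 'm::finite"
    and B\<^sub>c P P\<^sub>T \<alpha> :: real
  assumes "B\<^sub>c > 0"
    and "\<And>m. W\<^sub>1 $ m > 0" and "\<And>m. W\<^sub>2 $ m > 0"
    and "\<And>m. \<Gamma>\<^sub>1 $ m > 0" and "\<And>m. \<Gamma>\<^sub>2 $ m > 0"
    and "\<And>m. \<Gamma>\<^sub>1 $ m \<ge> \<Gamma>\<^sub>2 $ m"
    and "\<And>m. 1 < W\<^sub>2 $ m / W\<^sub>1 $ m"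
    and "\<And>m. W\<^sub>2 $ m / W\<^sub>1 $ m < \<Gamma>\<^sub>1 $ m / \<Gamma>\<^sub>2 $ m"
    and "\<And>m. \<Theta> $ m > 0"
    and "\<And>m. \<Theta> $ m > 2 * noma_Omega W\<^sub>1 W\<^sub>2 \<Gamma>\<^sub>1 \<Gamma>\<^sub>2 m"
    and "P \<ge> (\<Sum>m\<in>UNIV. \<Theta> $ m)"
    and "\<alpha> > 0"
  shows "(\<forall>lam\<ge>0. (\<Sum>m\<in>UNIV. noma_qstar W\<^sub>2 \<Gamma>\<^sub>2 B\<^sub>c \<Theta> \<alpha> lam $ m) = P \<longrightarrow>
            noma_the_optimum W\<^sub>1 W\<^sub>2 \<Gamma>\<^sub>1 \<Gamma>\<^sub>2 B\<^sub>c P\<^sub>T \<Theta> P \<alpha> (noma_qstar W\<^sub>2 \<Gamma>\<^sub>2 B\<^sub>c \<Theta> \<alpha> lam))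
    \<and> ((\<exists>lam\<ge>0. (\<Sum>m\<in>UNIV. noma_qstar W\<^sub>2 \<Gamma>\<^sub>2 B\<^sub>c \<Theta> \<alpha> lam $ m) = P) \<longleftrightarrow>
         P \<le> (\<Sum>m\<in>UNIV. noma_qstar W\<^sub>2 \<Gamma>\<^sub>2 B\<^sub>c \<Theta> \<alpha> 0 $ m))
    \<and> ((\<Sum>m\<in>UNIV. noma_qstar W\<^sub>2 \<Gamma>\<^sub>2 B\<^sub>c \<Theta> \<alpha> 0 $ m) < P \<longrightarrow>
         noma_the_optimum W\<^sub>1 W\<^sub>2 \<Gamma>\<^sub>1 \<Gamma>\<^sub>2 B\<^sub>c P\<^sub>T \<Theta> P \<alpha> (noma_qstar W\<^sub>2 \<Gamma>\<^sub>2 B\<^sub>c \<Theta> \<alpha> 0))"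
proof (intro conjI allI impI)
  have Omega: "noma_Omega W\<^sub>1 W\<^sub>2 \<Gamma>\<^sub>1 \<Gamma>\<^sub>2 m > 0" for m
    using assms by (intro noma_Omega_pos) auto
  note opt = noma_qstar_optimal[OF assms(1,3,5,9,12) _ Omega]
  show "noma_the_optimum W\<^sub>1 W\<^sub>2 \<Gamma>\<^sub>1 \<Gamma>\<^sub>2 B\<^sub>c P\<^sub>T \<Theta> P \<alpha> (noma_qstar W\<^sub>2 \<Gamma>\<^sub>2 B\<^sub>c \<Theta> \<alpha> lam)"
    if "lam \<ge> 0" "(\<Sum>m\<in>UNIV. noma_qstar W\<^sub>2 \<Gamma>\<^sub>2 B\<^sub>c \<Theta> \<alpha> lam $ m) = P" for lam
    using that by (intro opt) auto
  show "noma_the_optimum W\<^sub>1 W\<^sub>2 \<Gamma>\<^sub>1 \<Gamma>\<^sub>2 B\<^sub>c P\<^sub>T \<Theta> P \<alpha> (noma_qstar W\<^sub>2 \<Gamma>\<^sub>2 B\<^sub>c \<Theta> \<alpha> 0)"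
    if "(\<Sum>m\<in>UNIV. noma_qstar W\<^sub>2 \<Gamma>\<^sub>2 B\<^sub>c \<Theta> \<alpha> 0 $ m) < P"
    using that by (intro opt) auto
qed (intro noma_multiplier_exists_iff assms)

end
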